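(* Let $A,B\subseteq\mathbb{Z}$ with $\mathrm{BD}(A)=\alpha>0$ and $\mathrm{BD}(B)=\beta>0$. Then there exists a set of natural numbers $E\subseteq\mathbb{N}$ such that: (1) The Schnirelmann density satisfies $\sigma(E)\ge\alpha\beta$; (2) For every finite $F\subset E$ there exists $\epsilon>0$ such that for arbitrarily large intervals $J$ one finds a suitable shift $A_J=A-t_J$ with the property below; that is, for every $m\in\mathbb{N}$ there exist a finite interval $J\subset\mathbb{Z}$ with $|J|>m$ and an integer $t_J$ such that, with $A_J=A-t_J$, $$\frac{\left|\left(\bigcap_{e\in F}\big((A_J\cap B)-e\big)\right)\cap J\right|}{|J|}\ \ge\ \epsilon;$$ (3) Both $E\lhd_d A$ and $E\lhd_d B$, and hence: (a) $\Delta(E)\subseteq\Delta_0(A)\cap\Delta_0(B)$; (b) $\Delta_\epsilon(E)\subseteq\Delta_\epsilon(A)\cap\Delta_\epsilon(B)$ for all real $\epsilon\ge 0$; (c) $\Delta(E)\lhd_d A-B$.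
   Context: $\mathbb{N}$ is the set of positive integers. The upper Banach density of $A\subseteq\mathbb{Z}$ is $\mathrm{BD}(A)=\lim_{n\to\infty}\max_{x\in\mathbb{Z}}\frac{|A\cap[x+1,x+n]|}{n}=\inf_{n\in\mathbb{N}}\max_{x\in\mathbb{Z}}\frac{|A\cap[x+1,x+n]|}{n}$. The Schnirelmann density of $E\subseteq\mathbb{N}$ is $\sigma(E)=\inf_{n\in\mathbb{N}}|E\cap[1,n]|/n$. $X\lhd_d Y$ ("$X$ is densely embeddable in $Y$", for $X,Y\subseteq\mathbb{Z}$) means: for every finite $F\subseteq X$, the set $\bigcap_{x\in F}(Y-x)=\{t\in\mathbb{Z}\mid t+F\subseteq Y\}$ has positive upper Banach density. $A-B=\{a-b\mid a\in A,\ b\in B\}$, $A-t=\{a-t\mid a\in A\}$, $\Delta(A)=A-A$, and for real $\epsilon\ge0$, $\Delta_\epsilon(A)=\{t\in\mathbb{Z}\mid \mathrm{BD}(A\cap(A-t))>\epsilon\}$. *)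

theory Defs
  imports Complex_Main
begin

text \<open>
  Throughout, the positive integers are regarded as a subset of \<^typ>\<open>int\<close>, so that sets of
  positive integers and sets of integers can be compared directly.
\<close>

text \<open>The maximum is genuine: only the fractions \<open>k / n\<close> with \<open>k \<le> n\<close> occur
  (see \<open>finite_window_densities\<close>).\<close>

definition max_window_density :: "int set \<Rightarrow> nat \<Rightarrow> real" where
  "max_window_density A n = (MAX x::int. real (card (A \<inter> {x + 1..x + int n})) / real n)"

definition upper_banach_density :: "int set \<Rightarrow> real" where
  "upper_banach_density A = lim (\<lambda>n. max_window_density A n)"

definition schnirelmann_density :: "int set \<Rightarrow> real" where
  "schnirelmann_density E = (INF n\<in>{1::nat..}. real (card (E \<inter> {1..int n})) / real n)"

definition translate :: "int set \<Rightarrow> int \<Rightarrow> int set" where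
  "translate A t = {a - t | a. a \<in> A}"

definition difference_set :: "int set \<Rightarrow> int set \<Rightarrow> int set" where
  "difference_set A B = {a - b | a b. a \<in> A \<and> b \<in> B}"

definition Delta :: "int set \<Rightarrow> int set" where
  "Delta A = difference_set A A"

definition Delta_eps :: "real \<Rightarrow> int set \<Rightarrow> int set" where
  "Delta_eps \<epsilon> A = {t. upper_banach_density (A \<inter> translate A t) > \<epsilon>}"

text \<open>For \<open>F = {}\<close> the intersection below is \<^term>\<open>UNIV :: int set\<close>.\<close>

definition densely_embeddable :: "int set \<Rightarrow> int set \<Rightarrow> bool"  (infix "\<lhd>\<^sub>d" 50) where
  "X \<lhd>\<^sub>d Y \<longleftrightarrow> (\<forall>F. finite F \<and> F \<subseteq> X \<longrightarrow> upper_banach_density (\<Inter>x\<in>F. translate Y x) > 0)"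

lemma Inter_translate: "(\<Inter>x\<in>F. translate Y x) = {t. (\<lambda>x. t + x) ` F \<subseteq> Y}"
proof -
  have "t \<in> translate Y x \<longleftrightarrow> t + x \<in> Y" for t x
    by (force simp: translate_def)
  then show ?thesis by auto
qed

lemma card_window_le: "card (A \<inter> {x + 1..x + int n}) \<le> n"
  using card_mono[of "{x + 1..x + int n}" "A \<inter> {x + 1..x + int n}"] by simp

lemma finite_window_densities:
  "finite (range (\<lambda>x::int. real (card (A \<inter> {x + 1..x + int n})) / real n))"
proof (rule finite_subset)
  show "range (\<lambda>x::int. real (card (A \<inter> {x + 1..x + int n})) / real n)
      \<subseteq> (\<lambda>k. real k / real n) ` {..n}"
    using card_window_le by fastforce
qed simp

lemma window_card_le:
  "real (card (A \<inter> {x + 1..x + int n})) \<le> max_window_density A n * real n"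
proof (cases "n = 0")
  case False
  have "real (card (A \<inter> {x + 1..x + int n})) / real n \<le> max_window_density A n"
    unfolding max_window_density_def using finite_window_densities by (intro Max_ge) auto
  then show ?thesis using False by (simp add: field_simps)
qed simp

lemma max_window_attained:
  obtains x where "max_window_density A n * real n = real (card (A \<inter> {x + 1..x + int n}))"
proof (cases "n = 0")
  case True
  then show ?thesis using that[of 0] by simp
next
  case False
  have "max_window_density A n \<in> range (\<lambda>x::int. real (card (A \<inter> {x + 1..x + int n})) / real n)"
    unfolding max_window_density_def by (rule Max_in[OF finite_window_densities]) simp
  then obtain x where "max_window_density A n = real (card (A \<inter> {x + 1..x + int n})) / real n"
    by blast
  then show ?thesis using that[of x] False by simp
qed

lemma max_window_density_nonneg: "max_window_density A n \<ge> 0"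
proof (cases "n = 0")
  case True
  then show ?thesis by (simp add: max_window_density_def)
next
  case False
  obtain x where "max_window_density A n * real n = real (card (A \<inter> {x + 1..x + int n}))"
    by (rule max_window_attained)
  then have "0 \<le> max_window_density A n * real n" by simp
  then show ?thesis using False by (simp add: zero_le_mult_iff)
qed

lemma max_window_subadditive:
  "max_window_density A (m + n) * real (m + n)
     \<le> max_window_density A m * real m + max_window_density A n * real n"
proof -
  obtain x where x: "max_window_density A (m + n) * real (m + n)
      = real (card (A \<inter> {x + 1..x + int (m + n)}))"
    by (rule max_window_attained)
  have split: "A \<inter> {x + 1..x + int (m + n)}
      = (A \<inter> {x + 1..x + int m}) \<union> (A \<inter> {(x + int m) + 1..(x + int m) + int n})"
    by auto
  have "card (A \<inter> {x + 1..x + int (m + n)})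
      \<le> card (A \<inter> {x + 1..x + int m}) + card (A \<inter> {(x + int m) + 1..(x + int m) + int n})"
    unfolding split by (rule card_Un_le)
  then show ?thesis
    using x window_card_le[of A x m] window_card_le[of A "x + int m" n] by linarith
qed

lemma max_window_multiple:
  "max_window_density A (q * k + r) * real (q * k + r)
     \<le> real q * (max_window_density A k * real k) + real r"
proof (induction q)
  case 0
  obtain x where "max_window_density A r * real r = real (card (A \<inter> {x + 1..x + int r}))"
    by (rule max_window_attained)
  then show ?case using card_window_le[of A x r] by simp
next
  case (Suc q)
  have "max_window_density A (Suc q * k + r) * real (Suc q * k + r)
      \<le> max_window_density A k * real k
        + max_window_density A (q * k + r) * real (q * k + r)"
    using max_window_subadditive[of A k "q * k + r"] by (simp add: add.assoc)
  also have "\<dots> \<le> real (Suc q) * (max_window_density A k * real k) + real r"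
    using Suc by (simp add: algebra_simps)
  finally show ?case .
qed

lemma max_window_density_tendsto_INF:
  "(\<lambda>n. max_window_density A n) \<longlonglongrightarrow> (INF n\<in>{1::nat..}. max_window_density A n)"
proof (rule LIMSEQ_I)
  fix e :: real
  assume e: "e > 0"
  define L where "L = (INF n\<in>{1::nat..}. max_window_density A n)"
  have bdd: "bdd_below ((\<lambda>n. max_window_density A n) ` {1..})"
    using max_window_density_nonneg by (intro bdd_belowI[of _ 0]) auto
  have lower: "L \<le> max_window_density A n" if "n \<ge> 1" for n
    unfolding L_def using bdd that by (intro cINF_lower) auto
  have "\<exists>k\<in>{1::nat..}. max_window_density A k < L + e / 2"
    using e bdd unfolding L_def by (subst cINF_less_iff[symmetric]) auto
  then obtain k where k: "k \<ge> 1" "max_window_density A k < L + e / 2" by auto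
  obtain N :: nat where N: "real N > 2 * real k / e"
    using reals_Archimedean2 by blast
  have "\<bar>max_window_density A n - L\<bar> < e" if n: "n \<ge> max 1 N" for n
  proof -
    define d where "d = max_window_density A k"
    have d: "d \<ge> 0" by (simp add: d_def max_window_density_nonneg)
    have "max_window_density A n * real n
        \<le> real (n div k) * (d * real k) + real (n mod k)"
      using max_window_multiple[of A "n div k" k "n mod k"] by (simp add: d_def)
    moreover have "real (n div k) * real k \<le> real n"
      by (metis of_nat_le_iff of_nat_mult div_times_less_eq_dividend)
    then have "real (n div k) * (d * real k) \<le> d * real n"
      using mult_left_mono[OF _ d] by (metis mult.left_commute)
    moreover have "real (n mod k) < real k" using k(1) by simp
    moreover have "real k < e / 2 * real n"
    proof -
      have "2 * real k / e < real n" using N n by linarith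
      then show ?thesis using e by (simp add: field_simps)
    qed
    ultimately have "max_window_density A n * real n < (d + e / 2) * real n"
      by (simp add: algebra_simps)
    then have "max_window_density A n < d + e / 2" using n by simp
    then show ?thesis using lower[of n] n k(2) by (simp add: d_def)
  qed
  then show "\<exists>n0. \<forall>n\<ge>n0. norm (max_window_density A n -
      (INF n\<in>{1::nat..}. max_window_density A n)) < e"
    unfolding L_def[symmetric] real_norm_def by blast
qed

lemma upper_banach_density_eq_INF:
  "upper_banach_density A = (INF n\<in>{1::nat..}. max_window_density A n)"
  unfolding upper_banach_density_def by (rule limI[OF max_window_density_tendsto_INF])

end

theory Submission
  imports Defs
begin

text \<open>
  Averaging \<open>card ((A - t) \<inter> B \<inter> J)\<close> over many shifts \<open>t\<close> yields, for every \<open>N\<close>, a shift \<open>t\<close> and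
  an interval \<open>J\<close> of length \<open>N\<close> on which \<open>C = (A - t) \<inter> B\<close> has density at least \<open>\<alpha> \<beta> - 1 / N\<close>
  (\<open>dense_shifted_intersection\<close>). The set \<open>E\<close> is a limit of the sets \<open>C - x\<close>, seen from
  well-chosen positions \<open>x\<close> of \<open>J\<close>.

  Fix a level \<open>n\<close> and call \<open>x\<close> good if every window \<open>[x + 1, x + k]\<close> with \<open>k \<le> n\<close> meets \<open>C\<close> in at
  least \<open>\<alpha> \<beta> k\<close> points. A position that is not good starts a short window on which \<open>C\<close> has density
  below \<open>\<alpha> \<beta>\<close>, and below it by a fixed amount, since the numbers of points involved are integers
  of bounded size. Tiling \<open>J\<close> by such windows shows that the good positions occupy a
  fixed positive proportion of \<open>J\<close> (\<open>card_window_le_good\<close>). There are only \<open>2 ^ n\<close> possible patterns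
  \<open>(C - x) \<inter> [1, n]\<close>, so some good pattern occurs with a fixed positive frequency for infinitely
  many \<open>N\<close>. The good frequent patterns form a finitely branching tree with nodes at every level;
  an infinite branch (\<open>compatible_subsets_limit\<close>) is the set \<open>E\<close>. Goodness gives the Schnirelmann
  density, and frequency gives property (2); this is \<open>recurrent_pattern_set\<close>.

  Everything else follows from the frequency of patterns: projecting to \<open>A\<close> and to \<open>B\<close> gives the two
  dense embeddings. Dense embeddability of \<open>E\<close> in \<open>A\<close> passes to \<open>E \<inter> (E - t)\<close> and
  \<open>A \<inter> (A - t)\<close>, which yields (b) because \<open>X \<lhd>\<^sub>d Y\<close> forces \<open>X\<close> to have at most the upper
  Banach density of \<open>Y\<close>. Property (a) is the definition applied to two-element sets. For (c), if
  \<open>y + F \<subseteq> B\<close> and \<open>x + F \<subseteq> A\<close>, then \<open>(x - y) + (F - F) \<subseteq> A - B\<close>; here \<open>y\<close> can be fixed while \<open>x\<close>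
  runs through a set of positive upper Banach density.
\<close>

section \<open>Upper Banach density\<close>

lemma mem_translate_iff [simp]: "x \<in> translate A t \<longleftrightarrow> x + t \<in> A"
  by (force simp: translate_def)

lemma upper_banach_density_le_window:
  assumes "n \<ge> 1"
  shows "upper_banach_density A \<le> max_window_density A n"
  unfolding upper_banach_density_eq_INF using assms max_window_density_nonneg
  by (intro cINF_lower bdd_belowI[of _ 0]) auto

lemma dense_window_exists:
  assumes "n \<ge> 1"
  obtains x where "real (card (A \<inter> {x + 1..x + int n})) \<ge> upper_banach_density A * real n"
  using max_window_attained[of A n]
    mult_right_mono[OF upper_banach_density_le_window[OF assms, of A], of "real n"]
  by (metis of_nat_0_le_iff)

lemma upper_banach_density_le_1: "upper_banach_density A \<le> 1"
proof -
  obtain x where "real (card (A \<inter> {x + 1..x + int 1})) \<ge> upper_banach_density A * real 1"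
    using dense_window_exists[of 1 A] by auto
  then show ?thesis using card_window_le[of A x 1] by simp
qed

lemma upper_banach_density_ge:
  assumes "\<And>m. \<exists>n>m. \<exists>x. real (card (A \<inter> {x..<x + int n})) \<ge> c * real n"
  shows "upper_banach_density A \<ge> c"
proof (rule ccontr)
  assume "\<not> c \<le> upper_banach_density A"
  then have "eventually (\<lambda>n. max_window_density A n < c) sequentially"
    using max_window_density_tendsto_INF[of A] order_tendstoD(2)
    unfolding upper_banach_density_eq_INF by (metis not_le)
  then obtain m where m: "\<And>n. n \<ge> m \<Longrightarrow> max_window_density A n < c"
    unfolding eventually_sequentially by blast
  obtain n x where n: "n > m" and x: "real (card (A \<inter> {x..<x + int n})) \<ge> c * real n"
    using assms by blast
  have "{x..<x + int n} = {(x - 1) + 1..(x - 1) + int n}" by auto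
  then have "c * real n \<le> max_window_density A n * real n"
    using x window_card_le[of A "x - 1" n] by simp
  then show False using m[of n] n by simp
qed

text \<open>Translation invariance and monotonicity in one statement.\<close>

lemma upper_banach_density_mono_shift:
  assumes "\<And>F. \<lbrakk>finite F; F \<subseteq> X\<rbrakk> \<Longrightarrow> \<exists>t. (\<lambda>x. t + x) ` F \<subseteq> Y"
  shows "upper_banach_density X \<le> upper_banach_density Y"
proof -
  have "max_window_density X n \<le> max_window_density Y n" if "n \<ge> 1" for n
  proof -
    obtain x where x: "max_window_density X n * real n = real (card (X \<inter> {x + 1..x + int n}))"
      by (rule max_window_attained)
    obtain t where t: "(\<lambda>y. t + y) ` (X \<inter> {x + 1..x + int n}) \<subseteq> Y"
      using assms[of "X \<inter> {x + 1..x + int n}"] by auto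
    have "card (X \<inter> {x + 1..x + int n}) \<le> card (Y \<inter> {(t + x) + 1..(t + x) + int n})"
      by (rule card_inj_on_le[of "\<lambda>y. t + y"]) (use t in \<open>auto simp: inj_on_def\<close>)
    then have "max_window_density X n * real n \<le> max_window_density Y n * real n"
      using x window_card_le[of Y "t + x" n] by linarith
    then show ?thesis using that by simp
  qed
  then show ?thesis
    unfolding upper_banach_density_eq_INF using max_window_density_nonneg
    by (intro cINF_mono bdd_belowI[of _ 0]) auto
qed

lemma upper_banach_density_empty: "upper_banach_density {} = 0"
proof -
  have "max_window_density {} n = 0" for n by (simp add: max_window_density_def)
  then show ?thesis by (simp add: upper_banach_density_eq_INF)
qed

section \<open>Dense embeddability\<close>

lemma densely_embeddableD:
  "\<lbrakk>X \<lhd>\<^sub>d Y; finite F; F \<subseteq> X\<rbrakk> \<Longrightarrow> upper_banach_density (\<Inter>x\<in>F. translate Y x) > 0"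
  by (simp add: densely_embeddable_def)

lemma densely_embeddable_embeds:
  assumes "X \<lhd>\<^sub>d Y" "finite F" "F \<subseteq> X"
  obtains t where "(\<lambda>x. t + x) ` F \<subseteq> Y"
proof -
  have "(\<Inter>x\<in>F. translate Y x) \<noteq> {}"
    using densely_embeddableD[OF assms] upper_banach_density_empty by force
  then show ?thesis using that unfolding Inter_translate by blast
qed

lemma densely_embeddable_density_le:
  "X \<lhd>\<^sub>d Y \<Longrightarrow> upper_banach_density X \<le> upper_banach_density Y"
  by (rule upper_banach_density_mono_shift) (erule (2) densely_embeddable_embeds, rule exI)

text \<open>A finite \<open>F \<subseteq> X \<inter> (X - t)\<close> is moved into \<open>Y \<inter> (Y - t)\<close> by every shift that moves
  \<open>F \<union> (F + t) \<subseteq> X\<close> into \<open>Y\<close>.\<close>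

lemma densely_embeddable_self_intersection:
  assumes "X \<lhd>\<^sub>d Y"
  shows "X \<inter> translate X t \<lhd>\<^sub>d Y \<inter> translate Y t"
  unfolding densely_embeddable_def
proof (intro allI impI, elim conjE)
  fix F assume F: "finite F" "F \<subseteq> X \<inter> translate X t"
  have "(\<Inter>x\<in>F \<union> (\<lambda>x. x + t) ` F. translate Y x) = (\<Inter>x\<in>F. translate (Y \<inter> translate Y t) x)"
    by (auto simp: algebra_simps)
  moreover have "finite (F \<union> (\<lambda>x. x + t) ` F)" "F \<union> (\<lambda>x. x + t) ` F \<subseteq> X"
    using F by auto
  then have "upper_banach_density (\<Inter>x\<in>F \<union> (\<lambda>x. x + t) ` F. translate Y x) > 0"
    by (rule densely_embeddableD[OF assms])
  ultimately show "upper_banach_density (\<Inter>x\<in>F. translate (Y \<inter> translate Y t) x) > 0"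
    by simp
qed

lemma Delta_eps_subset:
  "X \<lhd>\<^sub>d Y \<Longrightarrow> Delta_eps \<epsilon> X \<subseteq> Delta_eps \<epsilon> Y"
  unfolding Delta_eps_def
  using densely_embeddable_density_le[OF densely_embeddable_self_intersection]
  by (fastforce intro: less_le_trans)

lemma Delta_subset_Delta_eps_0:
  assumes "X \<lhd>\<^sub>d Y"
  shows "Delta X \<subseteq> Delta_eps 0 Y"
proof
  fix t assume "t \<in> Delta X"
  then obtain e f where e: "e \<in> X" "f \<in> X" "t = e - f"
    unfolding Delta_def difference_set_def by blast
  have "0 < upper_banach_density (\<Inter>x\<in>{e, f}. translate Y x)"
    by (rule densely_embeddableD[OF assms]) (use e in auto)
  also have "\<dots> \<le> upper_banach_density (Y \<inter> translate Y t)"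
    by (rule upper_banach_density_mono_shift, rule exI[of _ f])
      (auto simp: e(3) subset_iff algebra_simps)
  finally show "t \<in> Delta_eps 0 Y" by (simp add: Delta_eps_def)
qed

text \<open>A finite \<open>G \<subseteq> E - E\<close> lies in \<open>F - F\<close> for some finite \<open>F \<subseteq> E\<close>; for a single \<open>y\<close> with
  \<open>y + F \<subseteq> B\<close>, every \<open>x\<close> with \<open>x + F \<subseteq> A\<close> gives a shift \<open>x - y\<close> that moves \<open>G\<close> into \<open>A - B\<close>.\<close>

lemma Delta_densely_embeddable:
  assumes "E \<lhd>\<^sub>d A" "E \<lhd>\<^sub>d B"
  shows "Delta E \<lhd>\<^sub>d difference_set A B"
  unfolding densely_embeddable_def
proof (intro allI impI, elim conjE)
  fix G assume G: "finite G" "G \<subseteq> Delta E"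
  have "\<forall>g\<in>G. \<exists>e f. e \<in> E \<and> f \<in> E \<and> g = e - f"
    using G(2) unfolding Delta_def difference_set_def by blast
  then obtain e f where ef: "\<And>g. g \<in> G \<Longrightarrow> e g \<in> E \<and> f g \<in> E \<and> g = e g - f g"
    by metis
  define F where "F = e ` G \<union> f ` G"
  have F: "finite F" "F \<subseteq> E" using G(1) ef by (auto simp: F_def)
  obtain y where y: "(\<lambda>x. y + x) ` F \<subseteq> B"
    using densely_embeddable_embeds[OF assms(2) F] .
  have "0 < upper_banach_density (\<Inter>x\<in>F. translate A x)"
    by (rule densely_embeddableD[OF assms(1) F])
  also have "\<dots> \<le> upper_banach_density (\<Inter>g\<in>G. translate (difference_set A B) g)"
  proof (rule upper_banach_density_mono_shift, rule exI[of _ "- y"])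
    fix H assume H: "H \<subseteq> (\<Inter>x\<in>F. translate A x)"
    have "- y + x + g \<in> difference_set A B" if "x \<in> H" "g \<in> G" for x g
    proof -
      have "x + e g \<in> A" using H that by (auto simp: F_def subset_iff)
      moreover have "y + f g \<in> B" using y that by (auto simp: F_def)
      moreover have "- y + x + g = (x + e g) - (y + f g)" using ef[OF that(2)] by simp
      ultimately show ?thesis unfolding difference_set_def by blast
    qed
    then show "(\<lambda>x. - y + x) ` H \<subseteq> (\<Inter>g\<in>G. translate (difference_set A B) g)" by auto
  qed
  finally show "0 < upper_banach_density (\<Inter>g\<in>G. translate (difference_set A B) g)" .
qed

section \<open>Dense intersections with a shift\<close>

text \<open>The intersection is averaged over \<open>N\<^sup>2\<close> shifts. Each \<open>b\<close> in the window of \<open>B\<close> is counted by the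
  shifts that move it into \<open>A\<close>; these shifts move \<open>b\<close> through a window of length \<open>N\<^sup>2\<close> which differs
  from a densest one for \<open>A\<close> by a displacement of at most \<open>N\<close>, so at least \<open>\<alpha> N\<^sup>2 - N\<close> of them count.\<close>

lemma dense_shifted_intersection:
  assumes N: "N \<ge> 1"
  shows "\<exists>t a. real (card (translate A t \<inter> B \<inter> {a + 1..a + int N}))
      \<ge> upper_banach_density A * upper_banach_density B * real N - 1"
proof (rule ccontr)
  define \<alpha> \<beta> where "\<alpha> = upper_banach_density A" and "\<beta> = upper_banach_density B"
  assume "\<not> ?thesis"
  then have small: "real (card (translate A t \<inter> B \<inter> {a + 1..a + int N})) < \<alpha> * \<beta> * real N - 1" for t a
    by (auto simp: \<alpha>_def \<beta>_def not_le)
  have NN: "N * N \<ge> 1" using N by simp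
  obtain u where u: "real (card (A \<inter> {u + 1..u + int (N * N)})) \<ge> \<alpha> * real (N * N)"
    unfolding \<alpha>_def using dense_window_exists[OF NN] .
  obtain a where a: "real (card (B \<inter> {a + 1..a + int N})) \<ge> \<beta> * real N"
    unfolding \<beta>_def using dense_window_exists[OF N] .
  define T where "T = {u - a + 1..u - a + int (N * N)}"
  define D where "D = B \<inter> {a + 1..a + int N}"
  have fin: "finite T" "finite D" by (auto simp: T_def D_def)
  have cT: "card T = N * N" by (simp add: T_def flip: of_nat_mult)
  have each: "\<alpha> * real (N * N) - real N \<le> real (card {t\<in>T. b + t \<in> A})" if b: "b \<in> D" for b
  proof -
    have "A \<inter> {u + 1..u + int (N * N)} \<subseteq> {u + 1..u + int N} \<union> (\<lambda>t. b + t) ` {t\<in>T. b + t \<in> A}"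
    proof
      fix x assume x: "x \<in> A \<inter> {u + 1..u + int (N * N)}"
      have "x - b \<in> T" if "x > u + int N" using b x that by (auto simp: T_def D_def)
      then show "x \<in> {u + 1..u + int N} \<union> (\<lambda>t. b + t) ` {t\<in>T. b + t \<in> A}"
        using x by (cases "x \<le> u + int N") (auto intro!: image_eqI[of _ _ "x - b"])
    qed
    then have "card (A \<inter> {u + 1..u + int (N * N)})
        \<le> card ({u + 1..u + int N} \<union> (\<lambda>t. b + t) ` {t\<in>T. b + t \<in> A})"
      using fin by (intro card_mono) auto
    also have "\<dots> \<le> card {u + 1..u + int N} + card ((\<lambda>t. b + t) ` {t\<in>T. b + t \<in> A})"
      by (rule card_Un_le)
    also have "\<dots> \<le> N + card {t\<in>T. b + t \<in> A}"
      using card_image_le[of "{t\<in>T. b + t \<in> A}"] fin by simp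
    finally show ?thesis using u by linarith
  qed
  have swap: "(\<Sum>t\<in>T. card {b\<in>D. b + t \<in> A}) = (\<Sum>b\<in>D. card {t\<in>T. b + t \<in> A})"
    using sum.swap_restrict[OF fin, of "\<lambda>_ _. 1::nat" "\<lambda>t b. b + t \<in> A"]
    by simp
  have "real (card D) * (\<alpha> * real (N * N) - real N) \<le> (\<Sum>b\<in>D. real (card {t\<in>T. b + t \<in> A}))"
    using sum_mono[of D "\<lambda>_. \<alpha> * real (N * N) - real N"] each by simp
  also have "\<dots> = (\<Sum>t\<in>T. real (card {b\<in>D. b + t \<in> A}))"
    unfolding of_nat_sum[symmetric] swap ..
  also have "\<dots> < (\<Sum>t\<in>T. \<alpha> * \<beta> * real N - 1)"
  proof (rule sum_strict_mono)
    show "T \<noteq> {}" using cT N by (metis card.empty NN not_one_le_zero)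
    fix t
    have "{b\<in>D. b + t \<in> A} = translate A t \<inter> B \<inter> {a + 1..a + int N}"
      by (auto simp: D_def)
    then show "real (card {b\<in>D. b + t \<in> A}) < \<alpha> * \<beta> * real N - 1" using small by simp
  qed (use fin in auto)
  also have "\<dots> = real N * (real N * (\<alpha> * \<beta> * real N - 1))" by (simp add: cT)
  finally have "real N * (real (card D) * (\<alpha> * real N - 1))
      < real N * (real N * (\<alpha> * \<beta> * real N - 1))"
    by (simp add: algebra_simps)
  then have upper: "real (card D) * (\<alpha> * real N - 1) < real N * (\<alpha> * \<beta> * real N - 1)"
    by (rule mult_less_cancel_left_pos[THEN iffD1, rotated]) (use N in simp)
  have \<alpha>\<beta>: "\<beta> \<le> 1" by (simp add: \<beta>_def upper_banach_density_le_1)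
  have pos: "\<alpha> * \<beta> * real N > 1" using small[of 0 0] by (smt (verit) of_nat_0_le_iff)
  have \<beta>0: "0 \<le> \<beta>"
    unfolding \<beta>_def upper_banach_density_eq_INF by (rule cINF_greatest) (auto simp: max_window_density_nonneg)
  have \<alpha>0: "0 \<le> \<alpha>"
    unfolding \<alpha>_def upper_banach_density_eq_INF by (rule cINF_greatest) (auto simp: max_window_density_nonneg)
  have "\<alpha> * \<beta> * real N \<le> \<alpha> * real N"
    using \<alpha>\<beta> \<beta>0 \<alpha>0 by (simp add: mult_left_le mult_right_mono)
  then have "\<beta> * real N * (\<alpha> * real N - 1) \<le> real (card D) * (\<alpha> * real N - 1)"
    using a pos by (intro mult_right_mono) (auto simp: D_def)
  moreover have "\<beta> * real N \<le> 1 * real N" using \<alpha>\<beta> by (intro mult_right_mono) auto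
  ultimately show False using upper by (simp add: algebra_simps)
qed

section \<open>Good positions\<close>

text \<open>The set \<open>C\<close> seen from \<open>x\<close>, up to distance \<open>n\<close>: \<open>(C - x) \<inter> [1, n]\<close>.\<close>

definition pattern :: "int set \<Rightarrow> nat \<Rightarrow> int \<Rightarrow> int set" where
  "pattern C n x = {k\<in>{1..int n}. x + k \<in> C}"

definition good :: "real \<Rightarrow> nat \<Rightarrow> int set \<Rightarrow> bool" where
  "good \<gamma> n P \<longleftrightarrow> (\<forall>k\<in>{1..n}. real (card (P \<inter> {1..int k})) \<ge> \<gamma> * real k)"

lemma pattern_subset: "pattern C n x \<subseteq> {1..int n}"
  by (auto simp: pattern_def)

lemma pattern_restrict: "m \<le> n \<Longrightarrow> pattern C n x \<inter> {1..int m} = pattern C m x"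
  by (auto simp: pattern_def)

lemma card_pattern: "card (pattern C k x) = card (C \<inter> {x + 1..x + int k})"
proof (rule bij_betw_same_card[of "\<lambda>y. x + y"])
  show "bij_betw (\<lambda>y. x + y) (pattern C k x) (C \<inter> {x + 1..x + int k})"
    by (rule bij_betw_byWitness[of _ "\<lambda>y. y - x"]) (auto simp: pattern_def)
qed

lemma good_restrict:
  assumes "good \<gamma> n P" "m \<le> n"
  shows "good \<gamma> m (P \<inter> {1..int m})"
  unfolding good_def
proof
  fix k assume k: "k \<in> {1..m}"
  then have "P \<inter> {1..int m} \<inter> {1..int k} = P \<inter> {1..int k}" by auto
  then show "\<gamma> * real k \<le> real (card (P \<inter> {1..int m} \<inter> {1..int k}))"
    using assms k by (simp add: good_def)
qed

text \<open>Only finitely many fractions \<open>j / k\<close> with \<open>j \<le> k \<le> n\<close> exist, so those below \<open>\<gamma>\<close> stay away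
  from \<open>\<gamma>\<close>.\<close>

lemma density_gap:
  fixes \<gamma> :: real
  assumes "\<gamma> > 0"
  obtains \<eta> where "0 < \<eta>" "\<eta> \<le> \<gamma>"
    "\<And>j k. \<lbrakk>1 \<le> k; k \<le> n; j \<le> k; real j < \<gamma> * real k\<rbrakk> \<Longrightarrow> real j \<le> (\<gamma> - \<eta>) * real k"
proof -
  define S where "S = insert \<gamma> ((\<lambda>(j, k). \<gamma> - real j / real k) `
      {(j, k) \<in> {..n} \<times> {1..n}. real j < \<gamma> * real k})"
  have "finite {(j, k) \<in> {..n} \<times> {1..n}. real j < \<gamma> * real k}"
    by (rule finite_subset[of _ "{..n} \<times> {1..n}"]) auto
  then have fin: "finite S" by (simp add: S_def)
  have "\<forall>s\<in>S. s > 0" using assms by (auto simp: S_def field_simps)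
  then have "Min S > 0" using fin by (subst Min_gr_iff) (auto simp: S_def)
  moreover have "Min S \<le> \<gamma>" using fin by (intro Min_le) (auto simp: S_def)
  moreover have "real j \<le> (\<gamma> - Min S) * real k"
    if "1 \<le> k" "k \<le> n" "j \<le> k" "real j < \<gamma> * real k" for j k
  proof -
    have "\<gamma> - real j / real k \<in> S" using that by (force simp: S_def)
    then have "Min S \<le> \<gamma> - real j / real k" using fin by simp
    then show ?thesis using that(1) by (simp add: field_simps)
  qed
  ultimately show ?thesis using that by blast
qed

text \<open>Walk through the window from the left: from a good position take a single step, which
  collects at most one point of \<open>C\<close>; from any other position jump over a window of length at most
  \<open>n\<close> where \<open>C\<close> has density at most \<open>\<gamma> - \<eta>\<close>. The summand \<open>n\<close> pays for the last, incomplete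
  jump.\<close>

lemma card_window_le_good:
  fixes \<gamma> \<eta> :: real
  assumes \<eta>: "0 < \<eta>" "\<eta> \<le> \<gamma>"
    and gap: "\<And>j k. \<lbrakk>1 \<le> k; k \<le> n; j \<le> k; real j < \<gamma> * real k\<rbrakk> \<Longrightarrow> real j \<le> (\<gamma> - \<eta>) * real k"
  shows "real (card (C \<inter> {x + 1..x + int L}))
    \<le> (\<gamma> - \<eta>) * real L + real (card {y\<in>{x..<x + int L}. good \<gamma> n (pattern C n y)}) + real n"
proof (induction L arbitrary: x rule: less_induct)
  case (less L)
  let ?G = "\<lambda>x L. {y\<in>{x..<x + int L}. good \<gamma> n (pattern C n y)}"
  let ?C = "\<lambda>x L. C \<inter> {x + 1..x + int L}"
  have nonneg: "(\<gamma> - \<eta>) * real L \<ge> 0" using \<eta> by simp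
  have jump: ?case
    if k: "1 \<le> k" "k \<le> L" and step: "real (card (?C x k)) \<le> (\<gamma> - \<eta>) * real k + real (card (?G x k))" for k
  proof -
    have L: "int L = int k + int (L - k)" using k by simp
    have "?C x L = ?C x k \<union> ?C (x + int k) (L - k)" unfolding L by auto
    then have "card (?C x L) \<le> card (?C x k) + card (?C (x + int k) (L - k))"
      by (metis card_Un_le)
    moreover have fin: "finite (?G y l)" for y l
      by (rule finite_subset[of _ "{y..<y + int l}"]) auto
    have "?G x L = ?G x k \<union> ?G (x + int k) (L - k)" unfolding L by auto
    then have "card (?G x L) = card (?G x k) + card (?G (x + int k) (L - k))"
      using card_Un_disjoint[OF fin fin, of x k "x + int k" "L - k"] by (force simp: disjoint_iff)
    moreover have "real (card (?C (x + int k) (L - k)))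
        \<le> (\<gamma> - \<eta>) * real (L - k) + real (card (?G (x + int k) (L - k))) + real n"
      using k by (intro less) auto
    moreover have "(\<gamma> - \<eta>) * real L = (\<gamma> - \<eta>) * real k + (\<gamma> - \<eta>) * real (L - k)"
      using k by (simp add: of_nat_diff algebra_simps)
    ultimately show ?thesis using step by linarith
  qed
  consider "L \<le> n" | "L > n" "good \<gamma> n (pattern C n x)" | "L > n" "\<not> good \<gamma> n (pattern C n x)"
    by linarith
  then show ?case
  proof cases
    case 1
    then show ?thesis using card_window_le[of C x L] nonneg by linarith
  next
    case 2
    then have "?G x 1 = {x}" by auto
    then show ?thesis
      using jump[of 1] 2 \<eta> card_window_le[of C x 1] by simp
  next
    case 3
    then obtain k where k: "1 \<le> k" "k \<le> n"
      and "real (card (pattern C n x \<inter> {1..int k})) < \<gamma> * real k"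
      by (auto simp: good_def not_le)
    then have "real (card (?C x k)) < \<gamma> * real k"
      by (simp add: pattern_restrict card_pattern)
    then have "real (card (?C x k)) \<le> (\<gamma> - \<eta>) * real k"
      using gap[OF k card_window_le] by blast
    then show ?thesis using jump[of k] k 3 by simp
  qed
qed

section \<open>A recurrent limit set\<close>

text \<open>Koenig's lemma for the tree of finite sets of positive integers, where the children of a
  subset of \<open>[1, n]\<close> are its extensions to \<open>[1, n + 1]\<close>.\<close>

lemma compatible_subsets_limit:
  fixes T :: "nat \<Rightarrow> int set \<Rightarrow> bool"
  assumes sub: "\<And>n P. T n P \<Longrightarrow> P \<subseteq> {1..int n}"
    and restrict: "\<And>m n P. \<lbrakk>T n P; m \<le> n\<rbrakk> \<Longrightarrow> T m (P \<inter> {1..int m})"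
    and ex: "\<And>n. \<exists>P. T n P"
  obtains E where "E \<subseteq> {1..}" "\<And>n. T n (E \<inter> {1..int n})"
proof -
  define ext where "ext n P \<longleftrightarrow> (\<forall>m\<ge>n. \<exists>Q. T m Q \<and> Q \<inter> {1..int n} = P)" for n P
  have ext0: "ext 0 {}" using ex by (auto simp: ext_def)
  have step: "\<exists>P'. ext (Suc n) P' \<and> P' \<inter> {1..int n} = P" if "ext n P" for n P
  proof (rule ccontr)
    assume none: "\<not> ?thesis"
    let ?S = "{P'. P' \<subseteq> {1..int (Suc n)} \<and> P' \<inter> {1..int n} = P}"
    have "\<forall>P'\<in>?S. \<exists>m\<ge>Suc n. \<forall>Q. T m Q \<longrightarrow> Q \<inter> {1..int (Suc n)} \<noteq> P'"
      using none unfolding ext_def by blast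
    then have "\<exists>m. \<forall>P'\<in>?S. Suc n \<le> m P' \<and> (\<forall>Q. T (m P') Q \<longrightarrow> Q \<inter> {1..int (Suc n)} \<noteq> P')"
      by (intro bchoice) blast
    then obtain m where m: "\<And>P'. P' \<in> ?S \<Longrightarrow> m P' \<ge> Suc n"
        "\<And>P' Q. P' \<in> ?S \<Longrightarrow> T (m P') Q \<Longrightarrow> Q \<inter> {1..int (Suc n)} \<noteq> P'"
      by blast
    have fin: "finite ?S" by (rule finite_subset[of _ "Pow {1..int (Suc n)}"]) auto
    define M where "M = Max (insert n (m ` ?S))"
    have M: "m P' \<le> M" if "P' \<in> ?S" for P' unfolding M_def using fin that by (intro Max_ge) auto
    have "n \<le> M" unfolding M_def using fin by (intro Max_ge) auto
    then obtain Q where Q: "T M Q" "Q \<inter> {1..int n} = P" using \<open>ext n P\<close> unfolding ext_def by blast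
    let ?P = "Q \<inter> {1..int (Suc n)}"
    have P: "?P \<in> ?S" using Q(2) by auto
    have "T (m ?P) (Q \<inter> {1..int (m ?P)})" using restrict Q(1) M[OF P] by blast
    moreover have "Q \<inter> {1..int (m ?P)} \<inter> {1..int (Suc n)} = ?P" using m(1)[OF P] by auto
    ultimately show False using m(2)[OF P] by blast
  qed
  obtain f where f: "\<And>n. ext n (f n)" "\<And>n. f (Suc n) \<inter> {1..int n} = f n"
    using dependent_nat_choice[of ext "\<lambda>n P P'. P' \<inter> {1..int n} = P"] ext0 step by metis
  have T: "T n (f n)" for n
    using f(1)[of n] sub unfolding ext_def by (metis inf.absorb_iff1 order_refl)
  have agree: "f (n + d) \<inter> {1..int n} = f n" for n d
  proof (induction d)
    case 0
    then show ?case using sub[OF T[of n]] by auto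
  next
    case (Suc d)
    have "f (n + Suc d) \<inter> {1..int n} = f (Suc (n + d)) \<inter> {1..int (n + d)} \<inter> {1..int n}" by auto
    also have "\<dots> = f n" unfolding f(2) by (rule Suc)
    finally show ?case .
  qed
  define E where "E = (\<Union>n. f n)"
  have "E \<inter> {1..int n} = f n" for n
  proof
    show "f n \<subseteq> E \<inter> {1..int n}" using sub[OF T] by (auto simp: E_def)
    show "E \<inter> {1..int n} \<subseteq> f n"
    proof
      fix x assume "x \<in> E \<inter> {1..int n}"
      then obtain i where x: "x \<in> f i" "x \<in> {1..int n}" by (auto simp: E_def)
      show "x \<in> f n"
      proof (cases "i \<le> n")
        case True
        then show ?thesis using agree[of i "n - i"] x by auto
      next
        case False
        then have "f i \<inter> {1..int n} = f n" using agree[of n "i - n"] by simp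
        then show ?thesis using x by blast
      qed
    qed
  qed
  moreover have "E \<subseteq> {1..}" using sub[OF T] by (fastforce simp: E_def)
  ultimately show ?thesis using that T by simp
qed

definition occurrences :: "int set \<Rightarrow> int \<Rightarrow> nat \<Rightarrow> nat \<Rightarrow> int set \<Rightarrow> int set" where
  "occurrences C a N n P = {x\<in>{a..<a + int N}. pattern C n x = P}"

lemma finite_occurrences [simp]: "finite (occurrences C a N n P)"
  by (rule finite_subset[of _ "{a..<a + int N}"]) (auto simp: occurrences_def)

text \<open>A finite form of Furstenberg's correspondence. At each level \<open>n\<close> the good positions fill a
  proportion \<open>\<eta> - o(1)\<close> of the window, where \<open>\<eta>\<close> depends only on \<open>\<gamma>\<close> and \<open>n\<close>; they are shared
  among boundedly many patterns, one of which is therefore frequent for infinitely many \<open>N\<close>. Being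
  good and being frequent both pass to shorter patterns, so a single infinite set has all its initial
  segments good and frequent.\<close>

lemma recurrent_pattern_set:
  fixes C :: "nat \<Rightarrow> int set" and a :: "nat \<Rightarrow> int" and \<gamma> c :: real
  assumes \<gamma>: "\<gamma> > 0"
    and dense: "\<And>N. N \<ge> 1 \<Longrightarrow> real (card (C N \<inter> {a N + 1..a N + int N})) \<ge> \<gamma> * real N - c"
  obtains E where "E \<subseteq> {1..}"
    "\<And>n. real (card (E \<inter> {1..int n})) \<ge> \<gamma> * real n"
    "\<And>n. \<exists>\<epsilon>>0. \<exists>\<^sub>F N in sequentially.
        real (card (occurrences (C N) (a N) N n (E \<inter> {1..int n}))) \<ge> \<epsilon> * real N"
proof -
  define freq where "freq n P \<longleftrightarrow> (\<exists>\<epsilon>>0. \<exists>\<^sub>F N in sequentially.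
      real (card (occurrences (C N) (a N) N n P)) \<ge> \<epsilon> * real N)" for n P
  define T where "T n P \<longleftrightarrow> P \<subseteq> {1..int n} \<and> good \<gamma> n P \<and> freq n P" for n P
  have ex: "\<exists>P. T n P" for n
  proof -
    obtain \<eta> where \<eta>: "0 < \<eta>" "\<eta> \<le> \<gamma>"
      "\<And>j k. \<lbrakk>1 \<le> k; k \<le> n; j \<le> k; real j < \<gamma> * real k\<rbrakk> \<Longrightarrow> real j \<le> (\<gamma> - \<eta>) * real k"
      using density_gap[OF \<gamma>, of n] by blast
    define S where "S = {P. P \<subseteq> {1..int n} \<and> good \<gamma> n P}"
    have finS: "finite S" by (rule finite_subset[of _ "Pow {1..int n}"]) (auto simp: S_def)
    define \<epsilon> where "\<epsilon> = \<eta> / 2 / (real (card S) + 1)"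
    have \<epsilon>: "\<epsilon> > 0" using \<eta> by (simp add: \<epsilon>_def)
    have popular: "\<exists>P\<in>S. real (card (occurrences (C N) (a N) N n P)) \<ge> \<epsilon> * real N"
      if N: "N \<ge> 1" "real N \<ge> 2 * (real n + c) / \<eta>" for N
    proof (rule ccontr)
      assume *: "\<not> ?thesis"
      let ?G = "{y\<in>{a N..<a N + int N}. good \<gamma> n (pattern (C N) n y)}"
      have "\<gamma> * real N - c \<le> (\<gamma> - \<eta>) * real N + real (card ?G) + real n"
        using dense[OF N(1)] card_window_le_good[OF \<eta>, of n "C N" "a N" N] by linarith
      moreover have "\<eta> * real N / 2 \<ge> real n + c" using N \<eta> by (simp add: field_simps)
      ultimately have low: "real (card ?G) \<ge> \<eta> / 2 * real N" by (simp add: algebra_simps)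
      have "?G = (\<Union>P\<in>S. occurrences (C N) (a N) N n P)"
        using pattern_subset by (auto simp: occurrences_def S_def)
      then have "card ?G \<le> (\<Sum>P\<in>S. card (occurrences (C N) (a N) N n P))"
        using card_UN_le[OF finS] by simp
      then have "real (card ?G) \<le> (\<Sum>P\<in>S. real (card (occurrences (C N) (a N) N n P)))"
        unfolding of_nat_sum[symmetric] by (rule of_nat_mono)
      also have "\<dots> \<le> (\<Sum>P\<in>S. \<epsilon> * real N)"
        using * by (intro sum_mono) (auto simp: not_le less_imp_le)
      also have "\<dots> = real (card S) * \<epsilon> * real N" by simp
      also have "\<dots> < (real (card S) + 1) * \<epsilon> * real N"
        using \<epsilon> N by (intro mult_strict_right_mono) auto
      also have "\<dots> = \<eta> / 2 * real N"
        by (simp add: \<epsilon>_def add_nonneg_eq_0_iff divide_simps)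
      finally show False using low by simp
    qed
    have "\<forall>\<^sub>F N in sequentially. N \<ge> 1 \<and> real N \<ge> 2 * (real n + c) / \<eta>"
    proof (rule eventually_conj[OF eventually_ge_at_top])
      obtain k :: nat where k: "2 * (real n + c) / \<eta> \<le> real k" using real_arch_simple by blast
      show "\<forall>\<^sub>F N in sequentially. real N \<ge> 2 * (real n + c) / \<eta>"
        using eventually_ge_at_top[of k] by eventually_elim (use k in linarith)
    qed
    then have "\<forall>\<^sub>F N in sequentially.
        \<exists>P\<in>S. real (card (occurrences (C N) (a N) N n P)) \<ge> \<epsilon> * real N"
      by eventually_elim (use popular in blast)
    then have "\<exists>\<^sub>F N in sequentially.
        \<exists>P\<in>S. real (card (occurrences (C N) (a N) N n P)) \<ge> \<epsilon> * real N"
      by (intro eventually_frequently) auto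
    then have "\<exists>P\<in>S. \<exists>\<^sub>F N in sequentially.
        real (card (occurrences (C N) (a N) N n P)) \<ge> \<epsilon> * real N"
      using finS by (simp add: frequently_bex_finite_distrib)
    then show ?thesis using \<epsilon> unfolding T_def freq_def S_def by blast
  qed
  have restrict: "T m (P \<inter> {1..int m})" if TP: "T n P" "m \<le> n" for m n P
  proof -
    obtain \<epsilon> where \<epsilon>: "\<epsilon> > 0"
      "\<exists>\<^sub>F N in sequentially. real (card (occurrences (C N) (a N) N n P)) \<ge> \<epsilon> * real N"
      using TP(1) unfolding T_def freq_def by blast
    have le: "real (card (occurrences (C N) (a N) N n P))
        \<le> real (card (occurrences (C N) (a N) N m (P \<inter> {1..int m})))" for N
      using \<open>m \<le> n\<close> by (intro of_nat_mono card_mono finite_occurrences) (auto simp: occurrences_def pattern_def)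
    have "\<exists>\<^sub>F N in sequentially.
        real (card (occurrences (C N) (a N) N m (P \<inter> {1..int m}))) \<ge> \<epsilon> * real N"
      by (rule frequently_elim1[OF \<epsilon>(2)]) (erule order_trans[OF _ le])
    then show ?thesis using TP good_restrict \<epsilon>(1) unfolding T_def freq_def by auto
  qed
  have sub: "P \<subseteq> {1..int n}" if "T n P" for n P
    using that by (simp add: T_def)
  obtain E where E: "E \<subseteq> {1..}" "\<And>n. T n (E \<inter> {1..int n})"
    by (rule compatible_subsets_limit[of T, OF sub restrict ex]) (assumption | rule that)+
  have "real (card (E \<inter> {1..int n})) \<ge> \<gamma> * real n" for n
  proof (cases "n = 0")
    case False
    then have "n \<in> {1..n}" by simp
    then have "\<gamma> * real n \<le> real (card (E \<inter> {1..int n} \<inter> {1..int n}))"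
      using E(2)[of n] unfolding T_def good_def by blast
    then show ?thesis by (simp only: Int_assoc Int_absorb)
  qed simp
  moreover have "\<exists>\<epsilon>>0. \<exists>\<^sub>F N in sequentially.
        real (card (occurrences (C N) (a N) N n (E \<inter> {1..int n}))) \<ge> \<epsilon> * real N" for n
    using E(2)[of n] by (simp add: T_def freq_def)
  ultimately show ?thesis using that E(1) by blast
qed

section \<open>The common embedded set\<close>

theorem mainTheorem3:
  fixes A B :: "int set" and \<alpha> \<beta> :: real
  assumes "upper_banach_density A = \<alpha>" and "\<alpha> > 0"
    and "upper_banach_density B = \<beta>" and "\<beta> > 0"
  shows "\<exists>E::int set. E \<subseteq> {1..} \<and>
    schnirelmann_density E \<ge> \<alpha> * \<beta> \<and>
    (\<forall>F. finite F \<and> F \<subseteq> E \<longrightarrow>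
      (\<exists>\<epsilon>::real. \<epsilon> > 0 \<and>
        (\<forall>m::nat. m \<ge> 1 \<longrightarrow>
          (\<exists>(J::int set) (t::int). (\<exists>a b. J = {a..b}) \<and> card J > m \<and>
            real (card ((\<Inter>e\<in>F. translate (translate A t \<inter> B) e) \<inter> J)) / real (card J) \<ge> \<epsilon>)))) \<and>
    (E \<lhd>\<^sub>d A \<and> E \<lhd>\<^sub>d B \<and>
      Delta E \<subseteq> Delta_eps 0 A \<inter> Delta_eps 0 B \<and>
      (\<forall>\<epsilon>::real. \<epsilon> \<ge> 0 \<longrightarrow> Delta_eps \<epsilon> E \<subseteq> Delta_eps \<epsilon> A \<inter> Delta_eps \<epsilon> B) \<and>
      Delta E \<lhd>\<^sub>d difference_set A B)"
proof -
  obtain t a where dense: "\<And>N. N \<ge> 1 \<Longrightarrow>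
      real (card (translate A (t N) \<inter> B \<inter> {a N + 1..a N + int N})) \<ge> \<alpha> * \<beta> * real N - 1"
    using dense_shifted_intersection[of _ A B] assms(1,3) by metis
  define C where "C N = translate A (t N) \<inter> B" for N
  have "\<alpha> * \<beta> > 0" using assms by simp
  then obtain E where E: "E \<subseteq> {1..}" "\<And>n. real (card (E \<inter> {1..int n})) \<ge> \<alpha> * \<beta> * real n"
    and freq: "\<And>n. \<exists>\<epsilon>>0. \<exists>\<^sub>F N in sequentially.
        real (card (occurrences (C N) (a N) N n (E \<inter> {1..int n}))) \<ge> \<epsilon> * real N"
    using recurrent_pattern_set[where \<gamma> = "\<alpha> * \<beta>" and C = C and a = a and c = 1] dense unfolding C_def by blast
  have sch: "schnirelmann_density E \<ge> \<alpha> * \<beta>"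
    unfolding schnirelmann_density_def using E(2)
    by (intro cINF_greatest) (auto simp: field_simps)
  have key: "\<exists>\<epsilon>>0. \<forall>m. \<exists>N>m.
      real (card ((\<Inter>e\<in>F. translate (C N) e) \<inter> {a N..<a N + int N})) \<ge> \<epsilon> * real N"
    if F: "finite F" "F \<subseteq> E" for F
  proof -
    define n where "n = nat (Max (insert 0 F))"
    have n: "F \<subseteq> E \<inter> {1..int n}"
    proof
      fix e assume e: "e \<in> F"
      then have "e \<le> Max (insert 0 F)" using F by simp
      then show "e \<in> E \<inter> {1..int n}" using e F E(1) by (auto simp: n_def)
    qed
    obtain \<epsilon> where \<epsilon>: "\<epsilon> > 0" "\<exists>\<^sub>F N in sequentially.
        real (card (occurrences (C N) (a N) N n (E \<inter> {1..int n}))) \<ge> \<epsilon> * real N"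
      using freq by blast
    have le: "card (occurrences (C N) (a N) N n (E \<inter> {1..int n}))
        \<le> card ((\<Inter>e\<in>F. translate (C N) e) \<inter> {a N..<a N + int N})" for N
      using n by (intro card_mono) (auto simp: occurrences_def pattern_def set_eq_iff subset_iff)
    have "\<exists>N>m. real (card ((\<Inter>e\<in>F. translate (C N) e) \<inter> {a N..<a N + int N})) \<ge> \<epsilon> * real N" for m
    proof -
      obtain N where "N \<ge> Suc m"
        "real (card (occurrences (C N) (a N) N n (E \<inter> {1..int n}))) \<ge> \<epsilon> * real N"
        using \<epsilon>(2) unfolding frequently_sequentially by blast
      then show ?thesis using le[of N] by (intro exI[of _ N]) linarith
    qed
    then show ?thesis using \<epsilon>(1) by blast
  qed
  have two: "\<exists>\<epsilon>::real. \<epsilon> > 0 \<and> (\<forall>m::nat. m \<ge> 1 \<longrightarrow>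
        (\<exists>(J::int set) (t::int). (\<exists>a b. J = {a..b}) \<and> card J > m \<and>
          real (card ((\<Inter>e\<in>F. translate (translate A t \<inter> B) e) \<inter> J)) / real (card J) \<ge> \<epsilon>))"
    if F: "finite F \<and> F \<subseteq> E" for F
  proof -
    obtain \<epsilon> where \<epsilon>: "\<epsilon> > 0" "\<And>m. \<exists>N>m.
        real (card ((\<Inter>e\<in>F. translate (C N) e) \<inter> {a N..<a N + int N})) \<ge> \<epsilon> * real N"
      using key F by blast
    have "\<exists>(J::int set) (t::int). (\<exists>a b. J = {a..b}) \<and> card J > m \<and>
        real (card ((\<Inter>e\<in>F. translate (translate A t \<inter> B) e) \<inter> J)) / real (card J) \<ge> \<epsilon>" for m
    proof -
      obtain N where N: "N > m"
        "real (card ((\<Inter>e\<in>F. translate (C N) e) \<inter> {a N..<a N + int N})) \<ge> \<epsilon> * real N"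
        using \<epsilon>(2) by blast
      have "{a N..<a N + int N} = {a N..a N + int N - 1}" by auto
      then have J: "\<exists>b c. {a N..<a N + int N} = {b..c}" by blast
      show ?thesis
        using N
        by (intro exI[of _ "{a N..<a N + int N}"] exI[of _ "t N"] conjI J)
          (auto simp: C_def field_simps)
    qed
    then show ?thesis using \<epsilon>(1) by blast
  qed
  have embA: "E \<lhd>\<^sub>d A"
    unfolding densely_embeddable_def
  proof (intro allI impI, elim conjE)
    fix F assume F: "finite F" "F \<subseteq> E"
    obtain \<epsilon> where \<epsilon>: "\<epsilon> > 0" "\<And>m. \<exists>N>m.
        real (card ((\<Inter>e\<in>F. translate (C N) e) \<inter> {a N..<a N + int N})) \<ge> \<epsilon> * real N"
      using key[OF F] by blast
    have le: "card ((\<Inter>e\<in>F. translate (C N) e) \<inter> {a N..<a N + int N})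
        \<le> card ((\<Inter>e\<in>F. translate A e) \<inter> {t N + a N..<t N + a N + int N})" for N
      by (rule card_inj_on_le[of "\<lambda>y. t N + y"])
        (auto simp: inj_on_def C_def algebra_simps)
    have "\<epsilon> \<le> upper_banach_density (\<Inter>e\<in>F. translate A e)"
    proof (rule upper_banach_density_ge)
      fix m
      obtain N where N: "N > m" "real (card ((\<Inter>e\<in>F. translate (C N) e) \<inter> {a N..<a N + int N})) \<ge> \<epsilon> * real N"
        using \<epsilon>(2) by blast
      show "\<exists>N>m. \<exists>x. real (card ((\<Inter>e\<in>F. translate A e) \<inter> {x..<x + int N})) \<ge> \<epsilon> * real N"
        using N le[of N] by (intro exI[of _ N] exI[of _ "t N + a N"] conjI) linarith+
    qed
    then show "0 < upper_banach_density (\<Inter>e\<in>F. translate A e)" using \<epsilon>(1) by linarith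
  qed
  have embB: "E \<lhd>\<^sub>d B"
    unfolding densely_embeddable_def
  proof (intro allI impI, elim conjE)
    fix F assume F: "finite F" "F \<subseteq> E"
    obtain \<epsilon> where \<epsilon>: "\<epsilon> > 0" "\<And>m. \<exists>N>m.
        real (card ((\<Inter>e\<in>F. translate (C N) e) \<inter> {a N..<a N + int N})) \<ge> \<epsilon> * real N"
      using key[OF F] by blast
    have le: "card ((\<Inter>e\<in>F. translate (C N) e) \<inter> {a N..<a N + int N})
        \<le> card ((\<Inter>e\<in>F. translate B e) \<inter> {a N..<a N + int N})" for N
      by (rule card_mono) (auto simp: C_def)
    have "\<epsilon> \<le> upper_banach_density (\<Inter>e\<in>F. translate B e)"
    proof (rule upper_banach_density_ge)
      fix m
      obtain N where N: "N > m" "real (card ((\<Inter>e\<in>F. translate (C N) e) \<inter> {a N..<a N + int N})) \<ge> \<epsilon> * real N"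
        using \<epsilon>(2) by blast
      show "\<exists>N>m. \<exists>x. real (card ((\<Inter>e\<in>F. translate B e) \<inter> {x..<x + int N})) \<ge> \<epsilon> * real N"
        using N le[of N] by (intro exI[of _ N] exI[of _ "a N"] conjI) linarith+
    qed
    then show "0 < upper_banach_density (\<Inter>e\<in>F. translate B e)" using \<epsilon>(1) by linarith
  qed
  show ?thesis
    using E(1) sch two embA embB Delta_subset_Delta_eps_0 Delta_eps_subset Delta_densely_embeddable
    by (intro exI[of _ E] conjI allI impI Int_greatest) auto
qed

end
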